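(* Let $R$ be a commutative ring with unity, let $m\ge1$ be an integer, and let $\lambda_1:\mathbb N\times\mathbb Z\to R$ be a lambda-recursive family of order $m$ with principal factor $(p_n)_{n\ge m}$. Then the boundary sequence $(\lambda_1(n,0))_{n\ge0}$ is completely determined by the initial values $\lambda_1(0,0),\dots,\lambda_1(m-1,0)$ and by the sequence $(p_n)_{n\ge m}$; equivalently, $$\lambda_1(n,0)=\lambda_1(m-1,0)\prod_{i=m}^{n}p_i\qquad\text{for all } n\ge m.$$
   Context: $\mathbb N=\{0,1,2,\dots\}$ and $w_m(n)=\lfloor n/m\rfloor$. A family $\lambda:\mathbb N\times\mathbb Z\to R$ has triangular support of order $m$ (written $\lambda\in\Delta_m$) if $\lambda(n,k)=0$ whenever $k<0$ or $k>w_m(n)$. A family $\lambda_1\in\Delta_m$ is lambda-recursive of order $m$ if there exist $p_n\in R$ (principal factor), $h_{(n,k)}\in R$ (auxiliary factor) and initial data $c_n\in R$ for $0\le n\le m-1$ such that, for all $n\in\mathbb N$ and $0\le k\le w_m(n)$: $\lambda_1(n,0)=c_n$ if $0\le n\le m-1$ (and $k=0$), and $\lambda_1(n,k)=p_n\,\lambda_1(n-1,k)-h_{(n,k)}\,\lambda_1(n-m,k-1)$ if $n\ge m$. *)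

theory Defs
  imports Main
begin

definition w :: "nat \<Rightarrow> nat \<Rightarrow> nat" where
  "w m n = n div m"

definition triangular_support :: "nat \<Rightarrow> (nat \<Rightarrow> int \<Rightarrow> 'a::zero) set" where
  "triangular_support m = {lam. \<forall>n k. k < 0 \<or> k > int (w m n) \<longrightarrow> lam n k = 0}"

text \<open>
  The sort \<open>{comm_ring, comm_monoid_mult}\<close> describes commutative rings with unity; unlike
  \<open>comm_ring_1\<close> it does not impose \<open>0 \<noteq> 1\<close>, so the zero ring is included.

  In \<open>lambda_recursive m p lam\<close>, \<open>p\<close> is the principal factor (only its values at indices
  \<open>n \<ge> m\<close> matter), \<open>c\<close> the initial data (used at \<open>n < m\<close>) and \<open>h\<close> the auxiliary factor.
  The notion is intended for \<open>m \<ge> 1\<close>; then the subtractions on \<open>nat\<close> are not truncated,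
  and \<open>n < m\<close> leaves \<open>k = 0\<close> as the only admissible index.
\<close>

definition lambda_recursive ::
    "nat \<Rightarrow> (nat \<Rightarrow> 'a) \<Rightarrow> (nat \<Rightarrow> int \<Rightarrow> 'a::{comm_ring, comm_monoid_mult}) \<Rightarrow> bool" where
  "lambda_recursive m p lam \<longleftrightarrow>
     lam \<in> triangular_support m \<and>
     (\<exists>c h. \<forall>n k. 0 \<le> k \<and> k \<le> int (w m n) \<longrightarrow>
        lam n k = (if n < m then c n
                   else p n * lam (n - 1) k - h n k * lam (n - m) (k - 1)))"

end

theory Submission
  imports Defs
begin

text \<open>On the boundary \<open>k = 0\<close> the auxiliary term contains
  \<open>lam (n - m) (- 1)\<close>, which vanishes by triangular support. The recursion thus
  collapses to a first-order one, \<open>lam n 0 = p n * lam (n - 1) 0\<close> for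
  \<open>n \<ge> m\<close> (\<open>lambda_recursive_boundary_step\<close>), and iterating it down to
  \<open>m - 1\<close> yields the product (\<open>lambda_recursive_boundary_eq_prod\<close>). The
  closed form mentions only one initial value and the \<open>p i\<close> with
  \<open>i \<ge> m\<close>, whence the determinacy.\<close>

lemma lambda_recursive_boundary_step:
  fixes lam :: "nat \<Rightarrow> int \<Rightarrow> 'a::{comm_ring, comm_monoid_mult}"
  assumes "lambda_recursive m p lam" "n \<ge> m"
  shows "lam n 0 = p n * lam (n - 1) 0"
proof -
  from assms obtain h where "lam n 0 = p n * lam (n - 1) 0 - h n 0 * lam (n - m) (- 1)"
    unfolding lambda_recursive_def by fastforce
  moreover have "lam (n - m) (- 1) = 0"
    using assms(1) by (simp add: lambda_recursive_def triangular_support_def)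
  ultimately show ?thesis by simp
qed

lemma lambda_recursive_boundary_eq_prod:
  fixes lam :: "nat \<Rightarrow> int \<Rightarrow> 'a::{comm_ring, comm_monoid_mult}"
  assumes "m \<ge> 1" "lambda_recursive m p lam" "n \<ge> m"
  shows "lam n 0 = lam (m - 1) 0 * (\<Prod>i=m..n. p i)"
  using assms(3)
proof (induction n rule: dec_induct)
  case base
  \<comment> \<open>Over \<open>{m..m}\<close> the product is the single factor \<open>p m\<close>,
    so one use of the recurrence at \<open>n = m\<close> suffices.\<close>
  show ?case
    using lambda_recursive_boundary_step[OF assms(2) order_refl] by (simp add: mult.commute)
next
  case (step n)
  have "lam (Suc n) 0 = p (Suc n) * lam n 0"
    using lambda_recursive_boundary_step[OF assms(2), of "Suc n"] step.hyps by simp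
  with step show ?case
    by (simp add: prod.nat_ivl_Suc' mult_ac)
qed

text \<open>The first conjunct renders "completely determined" as agreement of any two families with
  the same boundary data; their auxiliary factors, hidden by the existential in
  \<open>lambda_recursive\<close>, may differ.\<close>

theorem theorem3p6:
  fixes m :: nat
    and p :: "nat \<Rightarrow> 'a::{comm_ring, comm_monoid_mult}"
    and lam :: "nat \<Rightarrow> int \<Rightarrow> 'a"
  assumes "m \<ge> 1"
    and "lambda_recursive m p lam"
  shows "(\<forall>p' lam'. lambda_recursive m p' lam' \<and>
              (\<forall>n<m. lam' n 0 = lam n 0) \<and> (\<forall>n\<ge>m. p' n = p n) \<longrightarrow>
              (\<forall>n. lam' n 0 = lam n 0)) \<and>
         (\<forall>n\<ge>m. lam n 0 = lam (m - 1) 0 * (\<Prod>i=m..n. p i))"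
proof (intro conjI allI impI)
  fix p' lam' n
  assume *: "lambda_recursive m p' lam' \<and> (\<forall>n<m. lam' n 0 = lam n 0) \<and> (\<forall>n\<ge>m. p' n = p n)"
  show "lam' n 0 = lam n 0"
  proof (cases "n < m")
    case False
    then have "lam' n 0 = lam' (m - 1) 0 * (\<Prod>i=m..n. p' i)"
      using lambda_recursive_boundary_eq_prod assms(1) * by force
    \<comment> \<open>Since \<open>m \<ge> 1\<close>, the index \<open>m - 1\<close> lies below
      \<open>m\<close>, where the initial values agree; the product only runs over indices where
      \<open>p'\<close> and \<open>p\<close> agree.\<close>
    also have "\<dots> = lam (m - 1) 0 * (\<Prod>i=m..n. p i)"
      using assms(1) * by simp
    also have "\<dots> = lam n 0"
      using lambda_recursive_boundary_eq_prod[OF assms, of n] False by simp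
    finally show ?thesis .
  qed (use * in simp)
next
  fix n assume "n \<ge> m"
  then show "lam n 0 = lam (m - 1) 0 * (\<Prod>i=m..n. p i)"
    by (rule lambda_recursive_boundary_eq_prod[OF assms])
qed

end
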